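(* Let $q,a,b,z$ be complex numbers with $|b/a|<|z|<1$ and $|q|<\min\{1,|b|\}$. Then \[ \sum_{n=-\infty}^{\infty}\frac{(a)_n}{(b)_n}z^n = -1 +\frac{(b/a)_\infty(az)_\infty}{(b)_\infty(z)_\infty}\sum_{n=0}^{\infty}\frac{(a)_n(aqz/b)_n}{(q)_n(az)_n}(b/a)^n +\frac{(q/b)_\infty(bq/az)_\infty}{(q/a)_\infty(b/az)_\infty} \sum_{n=0}^{\infty}\frac{(b/a)_n(b/az)_n}{(q)_n(bq/az)_n}(q/b)^n . \]
   Context: For $|q|<1$ and complex $x$, $(x)_\infty=(x;q)_\infty=\prod_{k=0}^{\infty}(1-xq^k)$, and for any integer $n$ (positive, zero or negative), $(x)_n=(x)_\infty/(xq^n)_\infty$. *)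

theory Defs
  imports "HOL-Analysis.Analysis"
begin

definition qpoch_inf :: "complex \<Rightarrow> complex \<Rightarrow> complex" where
  "qpoch_inf q x = (\<Prod>k. 1 - x * q ^ k)"

text \<open>
  The symbol $(x)_n$ for an integer $n$ is $(x)_\infty / (x q^n)_\infty$. When $x$ is a nonpositive
  power of $q$ this quotient can be of the form $0/0$; the singularity is then removable, and
  \<open>qpoch\<close> takes the value obtained by cancelling the common factors, so that the second branch
  only completes the first one (see \<open>qpoch_of_nat\<close> and \<open>qpoch_neg_of_nat\<close> below).
\<close>

definition qpoch :: "complex \<Rightarrow> complex \<Rightarrow> int \<Rightarrow> complex" where
  "qpoch q x n =
     (if qpoch_inf q (x * q powi n) \<noteq> 0
      then qpoch_inf q x / qpoch_inf q (x * q powi n)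
      else (\<Prod>k<nat n. 1 - x * q ^ k) / (\<Prod>k<nat (- n). 1 - x * q powi n * q ^ k))"

lemma convergent_prod_qpoch:
  fixes q x :: complex
  assumes "norm q < 1"
  shows "convergent_prod (\<lambda>k. 1 - x * q ^ k)"
proof -
  have "summable (\<lambda>k. norm (x * q ^ k))"
    using assms by (simp add: norm_mult norm_power summable_mult summable_geometric)
  then have "abs_convergent_prod (\<lambda>k. 1 - x * q ^ k)"
    by (simp add: abs_convergent_prod_conv_summable)
  then show ?thesis
    by (rule abs_convergent_prod_imp_convergent_prod)
qed

lemma qpoch_inf_eq_0_iff:
  assumes "norm q < 1"
  shows "qpoch_inf q x = 0 \<longleftrightarrow> (\<exists>k. x * q ^ k = 1)"
  using has_prod_eq_0_iff[OF convergent_prod_has_prod[OF convergent_prod_qpoch[OF assms, of x]]]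
  unfolding qpoch_inf_def by auto

lemma qpoch_inf_split:
  assumes "norm q < 1"
  shows "qpoch_inf q x = (\<Prod>k<m. 1 - x * q ^ k) * qpoch_inf q (x * q ^ m)"
proof -
  have lim: "(\<lambda>n. \<Prod>k<n. 1 - y * q ^ k) \<longlonglongrightarrow> qpoch_inf q y" for y
    using convergent_prod_LIMSEQ[OF convergent_prod_qpoch[OF assms, of y]]
    unfolding qpoch_inf_def LIMSEQ_lessThan_iff_atMost .
  have "(\<lambda>n. \<Prod>k<n + m. 1 - x * q ^ k) \<longlonglongrightarrow> qpoch_inf q x"
    using lim[of x] by (rule LIMSEQ_ignore_initial_segment)
  moreover have "(\<Prod>k<n + m. 1 - x * q ^ k)
      = (\<Prod>k<m. 1 - x * q ^ k) * (\<Prod>k<n. 1 - x * q ^ m * q ^ k)" for n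
    by (induction n) (simp_all add: power_add mult_ac)
  moreover have "(\<lambda>n. (\<Prod>k<m. 1 - x * q ^ k) * (\<Prod>k<n. 1 - x * q ^ m * q ^ k))
      \<longlonglongrightarrow> (\<Prod>k<m. 1 - x * q ^ k) * qpoch_inf q (x * q ^ m)"
    by (intro tendsto_mult tendsto_const lim)
  ultimately show ?thesis
    using LIMSEQ_unique by auto
qed

lemma qpoch_of_nat:
  assumes "norm q < 1"
  shows "qpoch q x (int m) = (\<Prod>k<m. 1 - x * q ^ k)"
  using qpoch_inf_split[OF assms, of x m] by (simp add: qpoch_def)

lemma qpoch_neg_of_nat:
  assumes "norm q < 1" and "q \<noteq> 0"
  shows "qpoch q x (- int m) = 1 / (\<Prod>k<m. 1 - x * q powi (- int m) * q ^ k)"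
proof -
  have "x * q powi (- int m) * q ^ m = x"
    using assms by (simp add: power_int_minus)
  then have "qpoch_inf q (x * q powi (- int m))
      = (\<Prod>k<m. 1 - x * q powi (- int m) * q ^ k) * qpoch_inf q x"
    using qpoch_inf_split[OF assms(1), of "x * q powi (- int m)" m] by metis
  then show ?thesis
    by (simp add: qpoch_def)
qed

end

theory Submission
  imports Defs "HOL-Complex_Analysis.Conformal_Mappings"
begin

text \<open>
  The halves \<open>n \<ge> 0\<close> and \<open>n \<le> 0\<close> of the bilateral series overlap in the term 1 and are the
  basic hypergeometric series \<open>\<^sub>2\<phi>\<^sub>1(q, a; b; z)\<close> and \<open>\<^sub>2\<phi>\<^sub>1(q, q/b; q/a; b/(az))\<close>. Heine's first
  transformation (expand a quotient of infinite products by the q-binomial theorem and interchange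
  the two summations) turns the second one into the last sum of the theorem. Iterating it gives
  Heine's second transformation, which turns the first one into the other sum; the intermediate
  series only converges for \<open>|a| < 1\<close>, but with \<open>w = b/a\<close> and \<open>z\<close> held fixed both sides, multiplied
  by \<open>(aw)\<^sub>\<infinity>\<close>, are entire in \<open>a\<close>.
\<close>

section \<open>Finite q-products and series with geometric majorants\<close>

definition qpoch_fin :: "complex \<Rightarrow> complex \<Rightarrow> nat \<Rightarrow> complex" where
  "qpoch_fin q x n = (\<Prod>k<n. 1 - x * q ^ k)"

lemma qpoch_fin_0 [simp]: "qpoch_fin q x 0 = 1"
  by (simp add: qpoch_fin_def)

lemma qpoch_fin_Suc: "qpoch_fin q x (Suc n) = qpoch_fin q x n * (1 - x * q ^ n)"
  by (simp add: qpoch_fin_def)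

text \<open>The Weierstrass M-test on the closed unit ball around each point, with the majorant for
  \<open>R = norm x + 1\<close>, gives locally uniform convergence of the holomorphic partial sums.
  The constants \<open>C\<close> and \<open>r\<close> may depend on \<open>R\<close>.\<close>

lemma holomorphic_on_suminf_geometric_bound:
  fixes f :: "nat \<Rightarrow> complex \<Rightarrow> complex"
  assumes hol: "\<And>n. f n holomorphic_on UNIV"
    and bound: "\<And>R. \<exists>C r. 0 \<le> r \<and> r < 1 \<and> (\<forall>n x. norm x \<le> R \<longrightarrow> norm (f n x) \<le> C * r ^ n)"
  shows "(\<lambda>x. \<Sum>n. f n x) holomorphic_on UNIV"
proof (rule holomorphic_uniform_sequence[where f = "\<lambda>N x. \<Sum>n<N. f n x"])
  show "\<exists>d>0. cball x d \<subseteq> UNIV \<and>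
      uniform_limit (cball x d) (\<lambda>N x. \<Sum>n<N. f n x) (\<lambda>x. \<Sum>n. f n x) sequentially" for x
  proof -
    obtain C r where r: "0 \<le> r" "r < 1"
      and C: "\<And>n y. norm y \<le> norm x + 1 \<Longrightarrow> norm (f n y) \<le> C * r ^ n"
      using bound[of "norm x + 1"] by blast
    have "norm y \<le> norm x + 1" if "y \<in> cball x 1" for y
      using that norm_triangle_ineq2[of y x] by (simp add: dist_norm norm_minus_commute)
    then have "uniform_limit (cball x 1) (\<lambda>N x. \<Sum>n<N. f n x) (\<lambda>x. \<Sum>n. f n x) sequentially"
      using r by (intro Weierstrass_m_test[where M = "\<lambda>n. C * r ^ n"])
        (auto intro!: C summable_mult summable_geometric)
    then show ?thesis by (intro exI[of _ 1]) auto
  qed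
qed (auto intro!: holomorphic_intros hol)

text \<open>The product majorant makes the double family absolutely summable, so Fubini for
  \<open>infsum\<close> applies. The remaining work is to pass between \<open>suminf\<close> and
  \<open>infsum\<close>, which needs absolute convergence of the rows, the columns and both outer
  series.\<close>

lemma suminf_swap_geometric:
  fixes f :: "nat \<Rightarrow> nat \<Rightarrow> complex"
  assumes r: "0 \<le> r" "r < 1" and s: "0 \<le> s" "s < 1"
    and bound: "\<And>m n. norm (f m n) \<le> C * r ^ m * s ^ n"
  shows "(\<Sum>m. \<Sum>n. f m n) = (\<Sum>n. \<Sum>m. f m n)"
proof -
  have row: "summable (\<lambda>n. norm (f m n))" for m
    by (rule summable_comparison_test'[where g = "\<lambda>n. C * r ^ m * s ^ n" and N = 0])
      (use bound s in \<open>auto intro!: summable_mult summable_geometric\<close>)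
  have col: "summable (\<lambda>m. norm (f m n))" for n
    by (rule summable_comparison_test'[where g = "\<lambda>m. C * s ^ n * r ^ m" and N = 0])
      (use bound[of _ n] r in \<open>simp_all add: mult.assoc mult.commute[of "s ^ n"] summable_mult summable_mult2 summable_geometric\<close>)
  \<comment> \<open>The factor \<open>1 / (1 - s)\<close> is the sum of the geometric series in
    \<open>s\<close>. The bound on sums of norms gives joint summability; the bound on the sums
    themselves lets the outer series be read as an \<open>infsum\<close>.\<close>
  have rowsum: "norm (\<Sum>n. f m n) \<le> (C * r ^ m) * (1 / (1 - s))"
    and rowsum': "norm (\<Sum>n. norm (f m n)) \<le> (C * r ^ m) * (1 / (1 - s))" for m
  proof -
    have "(\<Sum>n. norm (f m n)) \<le> (\<Sum>n. C * r ^ m * s ^ n)"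
      using s by (intro suminf_le bound row summable_mult summable_geometric) auto
    also have "\<dots> = (C * r ^ m) * (1 / (1 - s))"
      using s by (subst suminf_mult) (auto simp: suminf_geometric summable_geometric)
    finally have *: "(\<Sum>n. norm (f m n)) \<le> (C * r ^ m) * (1 / (1 - s))" .
    then show "norm (\<Sum>n. norm (f m n)) \<le> (C * r ^ m) * (1 / (1 - s))"
      by (simp add: suminf_nonneg row)
    show "norm (\<Sum>n. f m n) \<le> (C * r ^ m) * (1 / (1 - s))"
      using summable_norm[OF row[of m]] * by linarith
  qed
  have colsum: "norm (\<Sum>m. f m n) \<le> (C * s ^ n) * (1 / (1 - r))" for n
  proof -
    have "norm (\<Sum>m. f m n) \<le> (\<Sum>m. norm (f m n))"
      by (rule summable_norm[OF col])
    also have "\<dots> \<le> (\<Sum>m. C * s ^ n * r ^ m)"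
      using r bound by (intro suminf_le col summable_mult summable_geometric) (auto simp: mult_ac)
    also have "\<dots> = (C * s ^ n) * (1 / (1 - r))"
      using r by (subst suminf_mult) (auto simp: suminf_geometric summable_geometric)
    finally show ?thesis .
  qed
  have inf_eq: "infsum g UNIV = suminf g" if "summable (\<lambda>n. norm (g n))" for g :: "nat \<Rightarrow> complex"
    by (rule infsumI[OF norm_summable_imp_has_sum[OF that summable_sums[OF summable_norm_cancel[OF that]]]])
  have "(\<lambda>x. norm (case x of (m, n) \<Rightarrow> f m n)) summable_on UNIV \<times> UNIV"
  proof (subst Infinite_Sum.abs_summable_on_Sigma_iff, intro conjI ballI)
    fix m
    show "(\<lambda>n. norm (case (m, n) of (m, n) \<Rightarrow> f m n)) summable_on UNIV"
      using norm_summable_imp_summable_on[of "\<lambda>n. norm (f m n)"] row[of m] by simp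
  next
    have eq: "infsum (\<lambda>n. norm (f m n)) UNIV = (\<Sum>n. norm (f m n))" for m
      using row by (intro infsumI norm_summable_imp_has_sum[OF _ summable_sums]) auto
    have "summable (\<lambda>m. norm (\<Sum>n. norm (f m n)))"
      by (rule summable_comparison_test'[where g = "\<lambda>m. C * r ^ m * (1 / (1 - s))" and N = 0])
        (use rowsum' r in \<open>auto intro!: summable_mult summable_mult2 summable_divide summable_geometric\<close>)
    then show "(\<lambda>m. norm (infsum (\<lambda>n. norm (case (m, n) of (m, n) \<Rightarrow> f m n)) UNIV)) summable_on UNIV"
      by (simp add: eq norm_summable_imp_summable_on)
  qed
  then have "(\<lambda>(m, n). f m n) summable_on UNIV \<times> UNIV"
    by (rule abs_summable_summable)
  then have swap: "infsum (\<lambda>m. infsum (f m) UNIV) UNIV = infsum (\<lambda>n. infsum (\<lambda>m. f m n) UNIV) UNIV"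
    by (rule infsum_swap_banach)
  have "summable (\<lambda>m. norm (\<Sum>n. f m n))"
    by (rule summable_comparison_test'[where g = "\<lambda>m. C * r ^ m * (1 / (1 - s))" and N = 0])
      (use rowsum r in \<open>auto intro!: summable_mult summable_mult2 summable_divide summable_geometric\<close>)
  moreover have "summable (\<lambda>n. norm (\<Sum>m. f m n))"
    by (rule summable_comparison_test'[where g = "\<lambda>m. C * s ^ m * (1 / (1 - r))" and N = 0])
      (use colsum s in \<open>auto intro!: summable_mult summable_mult2 summable_divide summable_geometric\<close>)
  ultimately show ?thesis
    using swap row col by (simp add: inf_eq)
qed

section \<open>Limits, bounds and holomorphy of q-products\<close>

locale q_disc =
  fixes q :: complex
  assumes norm_q: "norm q < 1"
begin

lemma qpoch_fin_tendsto: "qpoch_fin q x \<longlonglongrightarrow> qpoch_inf q x"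
  using convergent_prod_LIMSEQ[OF convergent_prod_qpoch[OF norm_q, of x]]
  unfolding qpoch_inf_def LIMSEQ_lessThan_iff_atMost[symmetric] qpoch_fin_def by simp

lemma qpoch_inf_eq_fin_mult: "qpoch_inf q x = qpoch_fin q x n * qpoch_inf q (x * q ^ n)"
  unfolding qpoch_fin_def by (rule qpoch_inf_split[OF norm_q])

lemma qpoch_inf_nonzero: "norm x < 1 \<Longrightarrow> qpoch_inf q x \<noteq> 0"
proof
  assume x: "norm x < 1" and "qpoch_inf q x = 0"
  then obtain k where "x * q ^ k = 1"
    using qpoch_inf_eq_0_iff[OF norm_q] by blast
  then have "norm x * norm q ^ k = 1"
    by (metis norm_mult norm_one norm_power)
  moreover have "norm x * norm q ^ k \<le> norm x * 1"
    using norm_q by (intro mult_left_mono power_le_one) auto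
  ultimately show False using x by simp
qed

lemma qpoch_fin_nonzero: "qpoch_inf q x \<noteq> 0 \<Longrightarrow> qpoch_fin q x n \<noteq> 0"
  using qpoch_inf_eq_fin_mult[of x n] by auto

text \<open>Each factor is at most \<open>exp (R * norm q ^ k)\<close> in norm, and the exponents
  form a geometric series. The bound is uniform in \<open>n\<close> and over the disc of radius
  \<open>R\<close>, as the holomorphy proofs require.\<close>

lemma norm_qpoch_fin_le:
  assumes "norm x \<le> R"
  shows "norm (qpoch_fin q x n) \<le> exp (R / (1 - norm q))"
proof -
  have R: "0 \<le> R" using assms norm_ge_zero order_trans by blast
  have "norm (qpoch_fin q x n) = (\<Prod>k<n. norm (1 - x * q ^ k))"
    by (simp add: qpoch_fin_def prod_norm)
  also have "\<dots> \<le> (\<Prod>k<n. exp (R * norm q ^ k))"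
  proof (intro prod_mono conjI)
    fix k
    have "norm (1 - x * q ^ k) \<le> 1 + norm x * norm q ^ k"
      using norm_triangle_ineq4[of 1 "x * q ^ k"] by (simp add: norm_mult norm_power)
    also have "\<dots> \<le> 1 + R * norm q ^ k"
      using assms by (simp add: mult_right_mono)
    also have "\<dots> \<le> exp (R * norm q ^ k)"
      by (rule exp_ge_add_one_self)
    finally show "norm (1 - x * q ^ k) \<le> exp (R * norm q ^ k)" .
  qed auto
  also have "\<dots> = exp (R * (\<Sum>k<n. norm q ^ k))"
    by (simp add: exp_sum sum_distrib_left)
  also have "(\<Sum>k<n. norm q ^ k) \<le> (\<Sum>k. norm q ^ k)"
    using norm_q by (intro sum_le_suminf summable_geometric) auto
  then have "exp (R * (\<Sum>k<n. norm q ^ k)) \<le> exp (R / (1 - norm q))"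
    using R norm_q mult_left_mono[of "\<Sum>k<n. norm q ^ k" "1 / (1 - norm q)" R]
    by (simp add: suminf_geometric)
  finally show ?thesis .
qed

lemma norm_qpoch_inf_le: "norm x \<le> R \<Longrightarrow> norm (qpoch_inf q x) \<le> exp (R / (1 - norm q))"
  by (rule Lim_bounded[OF tendsto_norm[OF qpoch_fin_tendsto], of 0]) (simp add: norm_qpoch_fin_le)

lemma norm_mult_q_power_le: "norm x \<le> R \<Longrightarrow> norm (x * q ^ n) \<le> R"
  using mult_left_mono[of "norm q ^ n" 1 "norm x"] norm_q
  by (simp add: norm_mult norm_power power_le_one)

text \<open>The quotients converge because the limit of the denominators is nonzero, and a
  convergent sequence is bounded.\<close>

lemma qpoch_fin_ratio_bounded:
  assumes "qpoch_inf q c \<noteq> 0"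
  obtains K where "0 \<le> K" "\<And>n. norm (qpoch_fin q a n / qpoch_fin q c n) \<le> K"
proof -
  have "(\<lambda>n. qpoch_fin q a n / qpoch_fin q c n) \<longlonglongrightarrow> qpoch_inf q a / qpoch_inf q c"
    by (intro tendsto_divide qpoch_fin_tendsto assms)
  then have "Bseq (\<lambda>n. qpoch_fin q a n / qpoch_fin q c n)"
    by (intro convergent_imp_Bseq convergentI)
  then show thesis
    using that less_imp_le unfolding Bseq_def by blast
qed

text \<open>Telescoping the differences (x)_(n+1) - (x)_n = -x q^n (x)_n turns the infinite product
  into a series with a geometric majorant on every disc.\<close>

lemma qpoch_inf_holomorphic: "qpoch_inf q holomorphic_on UNIV"
proof -
  have "qpoch_inf q x = 1 + (\<Sum>n. - (x * q ^ n * qpoch_fin q x n))" for x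
  proof -
    have "(\<lambda>n. qpoch_fin q x (Suc n) - qpoch_fin q x n) sums (qpoch_inf q x - qpoch_fin q x 0)"
      by (rule telescope_sums[OF qpoch_fin_tendsto])
    then have "(\<lambda>n. - (x * q ^ n * qpoch_fin q x n)) sums (qpoch_inf q x - 1)"
      by (simp add: qpoch_fin_Suc algebra_simps)
    then show ?thesis
      by (simp add: sums_iff)
  qed
  moreover have "(\<lambda>x. \<Sum>n. - (x * q ^ n * qpoch_fin q x n)) holomorphic_on UNIV"
  proof (rule holomorphic_on_suminf_geometric_bound)
    fix R
    have "norm (- (x * q ^ n * qpoch_fin q x n)) \<le> (R * exp (R / (1 - norm q))) * norm q ^ n"
      if "norm x \<le> R" for n x
    proof -
      have "norm x * norm (qpoch_fin q x n) \<le> R * exp (R / (1 - norm q))"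
        using that order_trans[OF norm_ge_zero that] by (intro mult_mono norm_qpoch_fin_le) auto
      from mult_right_mono[OF this, of "norm q ^ n"] show ?thesis
        by (simp add: norm_mult norm_power mult_ac)
    qed
    then show "\<exists>C r. 0 \<le> r \<and> r < 1 \<and> (\<forall>n x. norm x \<le> R \<longrightarrow>
        norm (- (x * q ^ n * qpoch_fin q x n)) \<le> C * r ^ n)"
      using norm_q by (intro exI[of _ "R * exp (R / (1 - norm q))"] exI[of _ "norm q"]) auto
  qed (auto simp: qpoch_fin_def intro!: holomorphic_intros)
  ultimately have "(\<lambda>x. qpoch_inf q x) holomorphic_on UNIV"
    by (simp only:) (intro holomorphic_intros)
  then show ?thesis .
qed

section \<open>The q-binomial theorem\<close>

lemma qbinomial_summable:
  assumes "norm z < 1"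
  shows "summable (\<lambda>n. qpoch_fin q a n / qpoch_fin q q n * z ^ n)"
proof -
  obtain K where K: "\<And>n. norm (qpoch_fin q a n / qpoch_fin q q n) \<le> K"
    using qpoch_fin_ratio_bounded[OF qpoch_inf_nonzero[OF norm_q]] by blast
  have "norm (qpoch_fin q a n / qpoch_fin q q n * z ^ n) \<le> K * norm z ^ n" for n
    unfolding norm_mult norm_power by (intro mult_right_mono K) auto
  moreover have "summable (\<lambda>n. K * norm z ^ n)"
    using assms by (intro summable_mult summable_geometric) simp
  ultimately show ?thesis
    by (rule summable_comparison_test'[rotated])
qed

text \<open>The coefficient recurrence \<open>c_Suc\<close> is equivalent to the functional equation
  (1 - x) f(x) = (1 - a x) f(x q). Iterating it N times moves the argument to z q^N, and continuity
  of f at 0 with f(0) = 1 leaves the quotient of infinite products.\<close>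

theorem qbinomial:
  assumes z: "norm z < 1"
  shows "(\<Sum>n. qpoch_fin q a n / qpoch_fin q q n * z ^ n) = qpoch_inf q (a * z) / qpoch_inf q z"
proof -
  define c where "c n = qpoch_fin q a n / qpoch_fin q q n" for n
  define f where "f x = (\<Sum>n. c n * x ^ n)" for x
  have c_Suc: "c (Suc n) * (1 - q ^ Suc n) = c n * (1 - a * q ^ n)" for n
    using qpoch_fin_nonzero[OF qpoch_inf_nonzero[OF norm_q], of "Suc n"]
    by (simp add: c_def qpoch_fin_Suc)
  have summ: "summable (\<lambda>n. c n * x ^ n)" if "norm x < 1" for x
    using qbinomial_summable[OF that] by (simp add: c_def)
  have step: "(1 - x) * f x = (1 - a * x) * f (x * q)" if x: "norm x < 1" for x
  proof -
    have xq: "norm (x * q) < 1"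
      using norm_mult_q_power_le[of x "norm x" 1] x by simp
    have s1: "(\<lambda>n. c n * x ^ n - c n * (x * q) ^ n) sums (f x - f (x * q))"
      unfolding f_def by (intro sums_diff summable_sums summ x xq)
    have s2: "(\<lambda>n. x * (c n * x ^ n) - a * x * (c n * (x * q) ^ n)) sums (x * f x - a * x * f (x * q))"
      unfolding f_def by (intro sums_diff sums_mult summable_sums summ x xq)
    have "x * (c n * x ^ n) - a * x * (c n * (x * q) ^ n)
        = c (Suc n) * x ^ Suc n - c (Suc n) * (x * q) ^ Suc n" for n
    proof -
      have "x * (c n * x ^ n) - a * x * (c n * (x * q) ^ n) = (c n * (1 - a * q ^ n)) * x ^ Suc n"
        by (simp add: algebra_simps power_mult_distrib)
      also have "\<dots> = c (Suc n) * x ^ Suc n - c (Suc n) * (x * q) ^ Suc n"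
        unfolding c_Suc[symmetric] by (simp add: algebra_simps power_mult_distrib)
      finally show ?thesis .
    qed
    then have "(\<lambda>n. c (Suc n) * x ^ Suc n - c (Suc n) * (x * q) ^ Suc n) sums (x * f x - a * x * f (x * q))"
      using s2 by simp
    \<comment> \<open>The term at \<open>n = 0\<close> is \<open>c 0 - c 0 = 0\<close>, so undoing
      the index shift does not change the sum.\<close>
    then have "(\<lambda>n. c n * x ^ n - c n * (x * q) ^ n) sums (x * f x - a * x * f (x * q))"
      by (subst (asm) sums_Suc_iff) simp
    then have "f x - f (x * q) = x * f x - a * x * f (x * q)"
      using s1 sums_unique2 by blast
    then show ?thesis by (simp add: algebra_simps)
  qed
  have iter: "qpoch_fin q z N * f z = qpoch_fin q (a * z) N * f (z * q ^ N)" for N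
  proof (induction N)
    case (Suc N)
    have "norm (z * q ^ N) < 1"
      using norm_mult_q_power_le[of z "norm z" N] z by simp
    from step[OF this] Suc show ?case
      by (simp add: qpoch_fin_Suc mult_ac) (metis (no_types, lifting) mult.assoc mult.left_commute)
  qed simp
  have "isCont f 0"
    unfolding f_def by (rule isCont_powser[where K = "1/2"]) (auto intro: summ)
  moreover have "(\<lambda>N. z * q ^ N) \<longlonglongrightarrow> 0"
    using norm_q by (intro tendsto_mult_right_zero LIMSEQ_power_zero)
  ultimately have "(\<lambda>N. f (z * q ^ N)) \<longlonglongrightarrow> f 0"
    by (rule isCont_tendsto_compose)
  moreover have "f 0 = 1"
    using powser_zero[of c] by (simp add: f_def c_def)
  ultimately have "(\<lambda>N. qpoch_fin q (a * z) N * f (z * q ^ N)) \<longlonglongrightarrow> qpoch_inf q (a * z) * 1"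
    by (intro tendsto_mult qpoch_fin_tendsto) simp
  moreover have "(\<lambda>N. qpoch_fin q z N * f z) \<longlonglongrightarrow> qpoch_inf q z * f z"
    by (intro tendsto_mult qpoch_fin_tendsto tendsto_const)
  ultimately have "qpoch_inf q z * f z = qpoch_inf q (a * z)"
    using LIMSEQ_unique by (simp add: iter)
  then show ?thesis
    using qpoch_inf_nonzero[OF z] by (simp add: f_def c_def field_simps)
qed

section \<open>Heine's transformations\<close>

text \<open>
  The terms of \<open>\<^sub>2\<phi>\<^sub>1(a, b; c; z)\<close> multiplied by \<open>(c)\<^sub>\<infinity>\<close>: since \<open>(c)\<^sub>\<infinity> / (c)\<^sub>n = (c q\<^sup>n)\<^sub>\<infinity>\<close>, no
  denominator can vanish and the sum is defined for all \<open>c\<close>.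
\<close>

definition heine_term :: "complex \<Rightarrow> complex \<Rightarrow> complex \<Rightarrow> complex \<Rightarrow> nat \<Rightarrow> complex" where
  "heine_term a b c z n =
     qpoch_fin q a n / qpoch_fin q q n * qpoch_fin q b n * qpoch_inf q (c * q ^ n) * z ^ n"

definition heine_sum :: "complex \<Rightarrow> complex \<Rightarrow> complex \<Rightarrow> complex \<Rightarrow> complex" where
  "heine_sum a b c z = (\<Sum>n. heine_term a b c z n)"

lemma heine_sum_commute: "heine_sum a b c z = heine_sum b a c z"
  by (simp add: heine_sum_def heine_term_def mult_ac)

text \<open>One exponential bounds (b)_n, the other (c q^n)_\<infinity>. The constant
  \<open>K\<close> is chosen before \<open>b\<close>, \<open>c\<close> and \<open>R\<close>, so the
  estimate is uniform over discs in \<open>b\<close> and \<open>c\<close>.\<close>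

lemma norm_heine_term_le:
  "\<exists>K. \<forall>b c R n. norm b \<le> R \<longrightarrow> norm c \<le> R \<longrightarrow>
     norm (heine_term a b c z n) \<le> K * exp (R / (1 - norm q)) * exp (R / (1 - norm q)) * norm z ^ n"
proof -
  obtain K where K: "0 \<le> K" "\<And>n. norm (qpoch_fin q a n / qpoch_fin q q n) \<le> K"
    using qpoch_fin_ratio_bounded[OF qpoch_inf_nonzero[OF norm_q]] by blast
  have "norm (heine_term a b c z n)
      \<le> K * exp (R / (1 - norm q)) * exp (R / (1 - norm q)) * norm z ^ n"
    if "norm b \<le> R" "norm c \<le> R" for b c R n
    unfolding heine_term_def norm_mult norm_power using that K(1)
    by (intro mult_right_mono mult_mono K(2) norm_qpoch_fin_le norm_qpoch_inf_le
        norm_mult_q_power_le) auto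
  then show ?thesis by blast
qed

lemma heine_term_summable:
  assumes "norm z < 1"
  shows "summable (\<lambda>n. norm (heine_term a b c z n))"
proof -
  obtain K where K: "\<And>b c R n. norm b \<le> R \<Longrightarrow> norm c \<le> R \<Longrightarrow>
       norm (heine_term a b c z n) \<le> K * exp (R / (1 - norm q)) * exp (R / (1 - norm q)) * norm z ^ n"
    using norm_heine_term_le[of a z] by blast
  define R where "R = max (norm b) (norm c)"
  show ?thesis
  proof (rule summable_comparison_test'[where N = 0])
    show "summable (\<lambda>n. K * exp (R / (1 - norm q)) * exp (R / (1 - norm q)) * norm z ^ n)"
      using assms by (intro summable_mult summable_geometric) auto
  qed (use K[of b R c] in \<open>auto simp: R_def\<close>)
qed

text \<open>Since \<open>norm w \<le> 1\<close>, the parameter \<open>b * w\<close> stays in every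
  disc around 0 that contains \<open>b\<close>, so the uniform term bound supplies a geometric
  majorant.\<close>

lemma heine_sum_holomorphic:
  assumes "norm z < 1" "norm w \<le> 1"
  shows "(\<lambda>b. heine_sum a b (b * w) z) holomorphic_on UNIV"
  unfolding heine_sum_def
proof (rule holomorphic_on_suminf_geometric_bound)
  fix n
  have "(\<lambda>b. qpoch_inf q (b * w * q ^ n)) holomorphic_on UNIV"
    by (rule holomorphic_on_compose_gen[OF _ qpoch_inf_holomorphic, unfolded o_def])
      (auto intro!: holomorphic_intros)
  then show "(\<lambda>b. heine_term a b (b * w) z n) holomorphic_on UNIV"
    unfolding heine_term_def qpoch_fin_def[of q b for b] by (intro holomorphic_intros)
next
  fix R
  obtain K where K: "\<And>b c R n. norm b \<le> R \<Longrightarrow> norm c \<le> R \<Longrightarrow>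
       norm (heine_term a b c z n) \<le> K * exp (R / (1 - norm q)) * exp (R / (1 - norm q)) * norm z ^ n"
    using norm_heine_term_le[of a z] by blast
  have "norm (b * w) \<le> R" if "norm b \<le> R" for b
    using that mult_left_mono[OF assms(2), of "norm b"] by (simp add: norm_mult)
  with K assms show "\<exists>C r. 0 \<le> r \<and> r < 1 \<and>
      (\<forall>n b. norm b \<le> R \<longrightarrow> norm (heine_term a b (b * w) z n) \<le> C * r ^ n)"
    by (intro exI[of _ "K * exp (R / (1 - norm q)) * exp (R / (1 - norm q))"] exI[of _ "norm z"]) auto
qed

text \<open>Both sides, divided by (b)_\<infinity> (z)_\<infinity>, are the double sum of A_n z^n
  B_m b^m q^(n m), summed first over m on the left and first over n on the right. Each inner sum is
  a q-binomial series.\<close>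

theorem heine_transformation:
  assumes b: "norm b < 1" "b \<noteq> 0" and z: "norm z < 1"
  shows "qpoch_inf q z * heine_sum a b c z = qpoch_inf q b * heine_sum (c / b) z (a * z) b"
proof -
  obtain K where K: "0 \<le> K" "\<And>n. norm (qpoch_fin q a n / qpoch_fin q q n) \<le> K"
    using qpoch_fin_ratio_bounded[OF qpoch_inf_nonzero[OF norm_q]] by blast
  obtain L where L: "0 \<le> L" "\<And>n. norm (qpoch_fin q (c / b) n / qpoch_fin q q n) \<le> L"
    using qpoch_fin_ratio_bounded[OF qpoch_inf_nonzero[OF norm_q]] by blast
  have small: "norm (x * q ^ n) < 1" if "norm x < 1" for x n
    using norm_mult_q_power_le[of x "norm x" n] that by simp
  define A where "A n = qpoch_fin q a n / qpoch_fin q q n" for n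
  define B where "B m = qpoch_fin q (c / b) m / qpoch_fin q q m" for m
  define f where "f n m = A n * z ^ n * (B m * (b * q ^ n) ^ m)" for n m
  \<comment> \<open>The coupling factor q^(n m) can be attached to \<open>b\<close> or to
    \<open>z\<close>; this choice selects which inner sum is a q-binomial series.\<close>
  have f_alt: "f n m = B m * b ^ m * (A n * (z * q ^ m) ^ n)" for n m
    by (simp add: f_def power_mult_distrib power_mult[symmetric] mult_ac)
  have bound: "norm (f n m) \<le> K * L * norm z ^ n * norm b ^ m" for n m
  proof -
    have "norm (f n m) = norm (A n) * norm z ^ n * (norm (B m) * norm (b * q ^ n) ^ m)"
      by (simp add: f_def norm_mult norm_power)
    also have "\<dots> \<le> K * norm z ^ n * (L * norm b ^ m)"
      using K L unfolding A_def B_def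
      by (intro mult_mono mult_right_mono power_mono norm_mult_q_power_le) auto
    finally show ?thesis by (simp add: mult_ac)
  qed
  \<comment> \<open>The q-binomial theorem gives (c q^n)_\<infinity> / (b q^n)_\<infinity>, and
    multiplying by (b)_\<infinity> turns the denominator into the factor (b)_n of the Heine
    term.\<close>
  have sum_m: "qpoch_inf q b * (\<Sum>m. f n m) = heine_term a b c z n" for n
  proof -
    have "(\<Sum>m. f n m) = A n * z ^ n * (\<Sum>m. B m * (b * q ^ n) ^ m)"
      unfolding f_def B_def by (intro suminf_mult qbinomial_summable small b)
    also have "\<dots> = A n * z ^ n * (qpoch_inf q (c * q ^ n) / qpoch_inf q (b * q ^ n))"
      unfolding B_def using b by (subst qbinomial[OF small]) (auto simp: field_simps)
    finally show ?thesis
      using qpoch_inf_eq_fin_mult[of b n] qpoch_inf_nonzero[OF small[OF b(1), of n]]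
      by (simp add: heine_term_def A_def)
  qed
  have sum_n: "qpoch_inf q z * (\<Sum>n. f n m) = heine_term (c / b) z (a * z) b m" for m
  proof -
    have "(\<Sum>n. f n m) = B m * b ^ m * (\<Sum>n. A n * (z * q ^ m) ^ n)"
      unfolding f_alt A_def by (intro suminf_mult qbinomial_summable small z)
    also have "\<dots> = B m * b ^ m * (qpoch_inf q (a * z * q ^ m) / qpoch_inf q (z * q ^ m))"
      unfolding A_def by (subst qbinomial[OF small[OF z]]) (auto simp: mult_ac)
    finally show ?thesis
      using qpoch_inf_eq_fin_mult[of z m] qpoch_inf_nonzero[OF small[OF z, of m]]
      by (simp add: heine_term_def B_def)
  qed
  have nz: "qpoch_inf q b \<noteq> 0" "qpoch_inf q z \<noteq> 0"
    using b z by (simp_all add: qpoch_inf_nonzero)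
  have "heine_sum a b c z = qpoch_inf q b * (\<Sum>n. \<Sum>m. f n m)"
  proof -
    have "(\<Sum>m. f n m) = heine_term a b c z n / qpoch_inf q b" for n
      using sum_m[of n] nz by (simp add: field_simps)
    then show ?thesis
      using nz suminf_divide[OF summable_norm_cancel[OF heine_term_summable[OF z]]]
      by (simp add: heine_sum_def)
  qed
  moreover have "heine_sum (c / b) z (a * z) b = qpoch_inf q z * (\<Sum>m. \<Sum>n. f n m)"
  proof -
    have "(\<Sum>n. f n m) = heine_term (c / b) z (a * z) b m / qpoch_inf q z" for m
      using sum_n[of m] nz by (simp add: field_simps)
    then show ?thesis
      using nz suminf_divide[OF summable_norm_cancel[OF heine_term_summable[OF b(1)]]]
      by (simp add: heine_sum_def)
  qed
  moreover have "(\<Sum>n. \<Sum>m. f n m) = (\<Sum>m. \<Sum>n. f n m)"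
    using bound b z by (intro suminf_swap_geometric[of "norm z" "norm b"]) auto
  ultimately show ?thesis by simp
qed

text \<open>For 0 < |b| < 1 two applications of the first transformation give the identity. Both
  sides are entire in \<open>b\<close> while \<open>w\<close> and \<open>z\<close> stay fixed, so
  the identity theorem extends it from the punctured disc to the plane.\<close>

theorem heine_transformation_2:
  assumes w: "norm w < 1" "w \<noteq> 0" and z: "norm z < 1"
  shows "qpoch_inf q z * heine_sum a b (b * w) z
       = qpoch_inf q w * heine_sum (a * z / w) b (b * z) w"
proof (rule analytic_continuation_open[where s = "ball 0 1 - {0}" and s' = UNIV
      and f = "\<lambda>b. qpoch_inf q z * heine_sum a b (b * w) z"
      and g = "\<lambda>b. qpoch_inf q w * heine_sum (a * z / w) b (b * z) w"])
  show "ball 0 1 - {0 :: complex} \<noteq> {}"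
  proof -
    have "1 / 2 \<in> ball 0 1 - {0 :: complex}" by simp
    then show ?thesis by blast
  qed
next
  fix b :: complex
  assume "b \<in> ball 0 1 - {0}"
  then have b: "norm b < 1" "b \<noteq> 0" by auto
  \<comment> \<open>The first application produces the parameter \<open>(b * w) / b = w\<close>;
    symmetry moves it to the second slot, where it serves as the base of the second
    application.\<close>
  have "qpoch_inf q z * heine_sum a b (b * w) z = qpoch_inf q b * heine_sum z w (a * z) b"
    using heine_transformation[OF b z, of a "b * w"] b by (simp add: heine_sum_commute[of w])
  also have "\<dots> = qpoch_inf q w * heine_sum (a * z / w) b (b * z) w"
    using heine_transformation[OF w b(1), of z "a * z"] by (simp add: mult.commute)
  finally show "qpoch_inf q z * heine_sum a b (b * w) z
      = qpoch_inf q w * heine_sum (a * z / w) b (b * z) w" .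
next
  show "(\<lambda>b. qpoch_inf q z * heine_sum a b (b * w) z) holomorphic_on UNIV"
    using w z by (intro holomorphic_intros heine_sum_holomorphic) auto
  \<comment> \<open>Here \<open>w\<close> is the argument of the series and \<open>z\<close> the
    scaling factor, so the holomorphy lemma is used with these two exchanged.\<close>
  show "(\<lambda>b. qpoch_inf q w * heine_sum (a * z / w) b (b * z) w) holomorphic_on UNIV"
    using w z by (intro holomorphic_intros heine_sum_holomorphic) auto
qed auto

section \<open>From Heine sums to the two halves of the bilateral series\<close>

text \<open>Dividing by (c)_\<infinity> undoes the normalisation, since (c q^n)_\<infinity> /
  (c)_\<infinity> = 1 / (c)_n, and recovers the usual basic hypergeometric term.\<close>

lemma heine_term_divide:
  assumes "qpoch_inf q c \<noteq> 0"
  shows "heine_term a b c z n / qpoch_inf q c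
       = qpoch_fin q a n * qpoch_fin q b n / (qpoch_fin q q n * qpoch_fin q c n) * z ^ n"
proof -
  have "qpoch_inf q (c * q ^ n) \<noteq> 0"
    using assms qpoch_inf_eq_fin_mult[of c n] by auto
  then show ?thesis
    unfolding heine_term_def qpoch_inf_eq_fin_mult[of c n] by simp
qed

lemma heine_term_divide_sums:
  assumes "norm z < 1" "qpoch_inf q c \<noteq> 0"
  shows "(\<lambda>n. qpoch_fin q a n * qpoch_fin q b n / (qpoch_fin q q n * qpoch_fin q c n) * z ^ n)
    sums (heine_sum a b c z / qpoch_inf q c)"
  unfolding heine_term_divide[OF assms(2), symmetric] heine_sum_def
  by (intro sums_divide summable_sums summable_norm_cancel[OF heine_term_summable] assms)

text \<open>With first parameter \<open>q\<close> the factor (q)_n cancels, which gives the shape of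
  each half of the bilateral series. Absolute summability is recorded for the unordered sum over the
  integers.\<close>

lemma heine_term_q_sums:
  assumes "norm z < 1" "qpoch_inf q c \<noteq> 0"
  shows "(\<lambda>n. qpoch_fin q b n / qpoch_fin q c n * z ^ n) sums (heine_sum q b c z / qpoch_inf q c)"
    and "summable (\<lambda>n. norm (qpoch_fin q b n / qpoch_fin q c n * z ^ n))"
proof -
  have eq: "qpoch_fin q b n / qpoch_fin q c n * z ^ n = heine_term q b c z n / qpoch_inf q c" for n
    using qpoch_fin_nonzero[OF qpoch_inf_nonzero[OF norm_q]]
    by (simp add: heine_term_divide[OF assms(2)])
  show "(\<lambda>n. qpoch_fin q b n / qpoch_fin q c n * z ^ n) sums (heine_sum q b c z / qpoch_inf q c)"
    unfolding eq heine_sum_def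
    by (intro sums_divide summable_sums summable_norm_cancel[OF heine_term_summable] assms)
  show "summable (\<lambda>n. norm (qpoch_fin q b n / qpoch_fin q c n * z ^ n))"
    unfolding eq norm_divide by (intro summable_divide heine_term_summable assms)
qed

text \<open>Each factor is reflected by 1 - x q^(-k-1) = -x q^(-k-1) (1 - (q/x) q^k). Only the power
  of x and (q/x)_m depend on x; the rest cancels in the quotient.\<close>

lemma qpoch_neg_ratio:
  assumes q: "q \<noteq> 0" and ab: "a \<noteq> 0" "b \<noteq> 0"
  shows "qpoch q a (- int m) / qpoch q b (- int m)
       = qpoch_fin q (q / b) m / qpoch_fin q (q / a) m * (b / a) ^ m"
proof -
  \<comment> \<open>\<open>D\<close> collects the signs and powers of \<open>q\<close> common to
    \<open>x = a\<close> and \<open>x = b\<close>.\<close>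
  define D where "D = (\<Prod>j<m. - (1 / q ^ Suc j))"
  have D: "D \<noteq> 0" using q by (simp add: D_def)
  have *: "(\<Prod>k<m. 1 - x * q powi (- int m) * q ^ k) = x ^ m * D * qpoch_fin q (q / x) m"
    if "x \<noteq> 0" for x
  proof -
    \<comment> \<open>Reversing the order makes the exponent of \<open>q\<close> equal to
      \<open>-(k + 1)\<close>, matching the factor of index \<open>k\<close> in (q/x)_m.\<close>
    have "(\<Prod>k<m. 1 - x * q powi (- int m) * q ^ k)
        = (\<Prod>k<m. 1 - x * q powi (- int m) * q ^ (m - Suc k))"
      by (rule prod.nat_diff_reindex[symmetric])
    also have "\<dots> = (\<Prod>k<m. x * - (1 / q ^ Suc k) * (1 - q / x * q ^ k))"
    proof (rule prod.cong)
      fix k assume "k \<in> {..<m}"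
      then have "q ^ m = q ^ (m - Suc k) * q ^ Suc k"
        by (subst power_add[symmetric]) simp
      then have "q powi (- int m) * q ^ (m - Suc k) = 1 / q ^ Suc k"
        using q by (simp add: power_int_minus field_simps)
      then show "1 - x * q powi (- int m) * q ^ (m - Suc k)
          = x * - (1 / q ^ Suc k) * (1 - q / x * q ^ k)"
        using q that by (simp add: mult.assoc) (simp add: field_simps)
    qed simp
    also have "\<dots> = x ^ m * D * qpoch_fin q (q / x) m"
      by (simp only: prod.distrib D_def qpoch_fin_def prod_constant card_lessThan)
    finally show ?thesis .
  qed
  \<comment> \<open>If (q/a)_m or (q/b)_m vanishes, both sides are 0 by the convention that division
    by 0 gives 0.\<close>
  show ?thesis
    unfolding qpoch_neg_of_nat[OF norm_q q] *[OF ab(1)] *[OF ab(2)]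
    using D by (simp add: power_divide mult_ac)
qed

end

text \<open>The index 0 occurs in both one-sided series, so \<open>f 0\<close> is subtracted once;
  this is the source of the -1 in the final formula. Absolute summability turns each ordered sum
  into an unordered one over \<open>{0..}\<close> or \<open>{..<0}\<close>.\<close>

lemma has_sum_int_split:
  fixes f :: "int \<Rightarrow> complex"
  assumes pos: "(\<lambda>n. f (int n)) sums P" "summable (\<lambda>n. norm (f (int n)))"
    and neg: "(\<lambda>n. f (- int n)) sums N" "summable (\<lambda>n. norm (f (- int n)))"
  shows "(f has_sum (P + N - f 0)) UNIV"
proof -
  have "(f \<circ> int has_sum P) UNIV"
    using norm_summable_imp_has_sum[OF pos(2,1)] by (simp add: o_def)
  moreover have "range int = {0..}"
    by (auto elim: nonneg_int_cases)
  ultimately have A: "(f has_sum P) {0..}"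
    by (metis has_sum_reindex inj_of_nat)
  have "(\<lambda>n. f (- int (Suc n))) sums (N - f 0)"
    using neg(1) by (subst sums_Suc_iff) simp
  moreover have "summable (\<lambda>n. norm (f (- int (Suc n))))"
    using neg(2) by (subst summable_Suc_iff)
  ultimately have "(f \<circ> (\<lambda>n. - int (Suc n)) has_sum (N - f 0)) UNIV"
    unfolding o_def by (intro norm_summable_imp_has_sum)
  moreover have "range (\<lambda>n. - int (Suc n)) = {..<0}"
  proof (intro equalityI subsetI)
    fix k :: int assume "k \<in> {..<0}"
    then have "k = - int (Suc (nat (- k - 1)))" by auto
    then show "k \<in> range (\<lambda>n. - int (Suc n))" by blast
  qed auto
  moreover have "inj (\<lambda>n. - int (Suc n))"
    by (auto simp: inj_on_def)
  ultimately have "(f has_sum (N - f 0)) {..<0}"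
    by (metis has_sum_reindex)
  with A have "(f has_sum (P + (N - f 0))) ({0..} \<union> {..<0})"
    by (intro has_sum_Un_disjoint) auto
  moreover have "{0..} \<union> {..<0} = (UNIV :: int set)" by auto
  ultimately show ?thesis by (simp add: add_diff_eq)
qed

section \<open>Evaluation of the bilateral series\<close>

text \<open>Convergence of all three series is asserted explicitly, since \<open>infsum\<close> and
  \<open>suminf\<close> also have values on divergent families. The last two hypotheses say that
  (b)_\<infinity> and (az)_\<infinity> are nonzero.\<close>

theorem theorem2p1:
  fixes q a b z :: complex
  assumes "norm (b / a) < norm z" and "norm z < 1" and "norm q < min 1 (norm b)"
    and "q \<noteq> 0" and "a \<noteq> 0"
    and "\<And>k::nat. b * q ^ k \<noteq> 1"
    and "\<And>k::nat. a * z * q ^ k \<noteq> 1"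
  shows "(\<lambda>n::int. qpoch q a n / qpoch q b n * z powi n) summable_on UNIV
    \<and> summable (\<lambda>n::nat. qpoch q a (int n) * qpoch q (a * q * z / b) (int n)
          / (qpoch q q (int n) * qpoch q (a * z) (int n)) * (b / a) ^ n)
    \<and> summable (\<lambda>n::nat. qpoch q (b / a) (int n) * qpoch q (b / (a * z)) (int n)
          / (qpoch q q (int n) * qpoch q (b * q / (a * z)) (int n)) * (q / b) ^ n)
    \<and> (\<Sum>\<^sub>\<infinity>n::int. qpoch q a n / qpoch q b n * z powi n) =
        - 1
        + qpoch_inf q (b / a) * qpoch_inf q (a * z) / (qpoch_inf q b * qpoch_inf q z)
          * (\<Sum>n::nat. qpoch q a (int n) * qpoch q (a * q * z / b) (int n)
               / (qpoch q q (int n) * qpoch q (a * z) (int n)) * (b / a) ^ n)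
        + qpoch_inf q (q / b) * qpoch_inf q (b * q / (a * z))
            / (qpoch_inf q (q / a) * qpoch_inf q (b / (a * z)))
          * (\<Sum>n::nat. qpoch q (b / a) (int n) * qpoch q (b / (a * z)) (int n)
               / (qpoch q q (int n) * qpoch q (b * q / (a * z)) (int n)) * (q / b) ^ n)"
proof -
  interpret q_disc q
    using assms(3) by unfold_locales simp
  have fin: "qpoch q x (int n) = qpoch_fin q x n" for x n
    by (simp add: qpoch_of_nat[OF norm_q] qpoch_fin_def)
  have z0: "z \<noteq> 0" and b0: "b \<noteq> 0"
    using assms by auto
  \<comment> \<open>The inequalities |q| < |b| < |a| and |b| < |a z| give every series argument
    modulus below 1 and make the remaining infinite products in denominators nonzero.\<close>
  have "norm (b / a) < 1" using assms(1,2) by simp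
  then have ab: "norm b < norm a"
    using assms(5) by (simp add: norm_divide divide_less_eq)
  have ba: "norm (b / a) < 1" "b / a \<noteq> 0"
    using \<open>norm (b / a) < 1\<close> b0 assms(5) by auto
  have qb: "norm (q / b) < 1" "q / b \<noteq> 0"
    using assms b0 by (auto simp: norm_divide divide_less_eq)
  have qa: "norm (q / a) < 1"
    using assms ab by (auto simp: norm_divide divide_less_eq)
  have baz: "norm (b / (a * z)) < 1"
    using assms z0 by (auto simp: norm_divide norm_mult field_simps)
  have bqaz: "norm (b * q / (a * z)) < 1"
    using norm_mult_q_power_le[of "b / (a * z)" _ 1, OF order_refl] baz by simp
  have nz: "qpoch_inf q b \<noteq> 0" "qpoch_inf q (a * z) \<noteq> 0"
    using assms(6,7) by (auto simp: qpoch_inf_eq_0_iff[OF norm_q])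
  note nz' = qpoch_inf_nonzero[OF qa] qpoch_inf_nonzero[OF baz] qpoch_inf_nonzero[OF bqaz]
    qpoch_inf_nonzero[OF assms(2)]
  define f where "f n = qpoch q a n / qpoch q b n * z powi n" for n
  have f_pos: "f (int n) = qpoch_fin q a n / qpoch_fin q b n * z ^ n" for n
    by (simp add: f_def fin)
  \<comment> \<open>Reflection contributes (b/a)^n and \<open>z powi (- int n)\<close> contributes
    z^(-n), so the negative half is a series in b/(az).\<close>
  have f_neg: "f (- int n) = qpoch_fin q (q / b) n / qpoch_fin q (q / a) n * (b / (a * z)) ^ n" for n
    unfolding f_def qpoch_neg_ratio[OF assms(4,5) b0]
    using z0 by (simp add: power_int_minus power_divide power_mult_distrib field_simps)
  have f_0: "f 0 = 1"
    using f_pos[of 0] by simp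
  have total: "(f has_sum (heine_sum q a b z / qpoch_inf q b
      + heine_sum q (q / b) (q / a) (b / (a * z)) / qpoch_inf q (q / a) - 1)) UNIV"
    using has_sum_int_split[of f, unfolded f_pos f_neg f_0,
        OF heine_term_q_sums[OF assms(2) nz(1)] heine_term_q_sums[OF baz nz'(1)]] .
  have S1: "(\<lambda>n. qpoch q a (int n) * qpoch q (a * q * z / b) (int n)
          / (qpoch q q (int n) * qpoch q (a * z) (int n)) * (b / a) ^ n)
      sums (heine_sum a (a * q * z / b) (a * z) (b / a) / qpoch_inf q (a * z))"
    unfolding fin by (intro heine_term_divide_sums ba nz)
  have S2: "(\<lambda>n. qpoch q (b / a) (int n) * qpoch q (b / (a * z)) (int n)
          / (qpoch q q (int n) * qpoch q (b * q / (a * z)) (int n)) * (q / b) ^ n)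
      sums (heine_sum (b / a) (b / (a * z)) (b * q / (a * z)) (q / b) / qpoch_inf q (b * q / (a * z)))"
    unfolding fin by (intro heine_term_divide_sums qb nz')
  \<comment> \<open>Heine's second transformation with parameters \<open>q\<close> and
    \<open>a\<close> and with \<open>w = b / a\<close>, so that \<open>a * w = b\<close> and
    \<open>q * z / w = a * q * z / b\<close>.\<close>
  have H1: "qpoch_inf q z * heine_sum q a b z
      = qpoch_inf q (b / a) * heine_sum a (a * q * z / b) (a * z) (b / a)"
    using heine_transformation_2[OF ba assms(2), of q a] assms(5)
    by (simp add: heine_sum_commute[of a] mult_ac)
  \<comment> \<open>Heine's first transformation with base \<open>q / b\<close> and lower parameter
    \<open>q / a\<close>: their quotient is \<open>b / a\<close>, and the new lower parameter is
    \<open>q\<close> times the argument \<open>b / (a * z)\<close>.\<close>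
  have H2: "qpoch_inf q (b / (a * z)) * heine_sum q (q / b) (q / a) (b / (a * z))
      = qpoch_inf q (q / b) * heine_sum (b / a) (b / (a * z)) (b * q / (a * z)) (q / b)"
    using heine_transformation[OF qb baz, of q "q / a"] assms(4) b0 by (simp add: mult_ac)
  have E1: "heine_sum q a b z
      = qpoch_inf q (b / a) * heine_sum a (a * q * z / b) (a * z) (b / a) / qpoch_inf q z"
    using nz'(4) by (simp flip: H1)
  have E2: "heine_sum q (q / b) (q / a) (b / (a * z))
      = qpoch_inf q (q / b) * heine_sum (b / a) (b / (a * z)) (b * q / (a * z)) (q / b)
        / qpoch_inf q (b / (a * z))"
    using nz'(2) by (simp flip: H2)
  show ?thesis
    unfolding f_def[symmetric]
  proof (intro conjI)
    show "f summable_on UNIV" using total by (rule has_sum_imp_summable)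
    show "infsum f UNIV = - 1
        + qpoch_inf q (b / a) * qpoch_inf q (a * z) / (qpoch_inf q b * qpoch_inf q z)
          * (\<Sum>n::nat. qpoch q a (int n) * qpoch q (a * q * z / b) (int n)
               / (qpoch q q (int n) * qpoch q (a * z) (int n)) * (b / a) ^ n)
        + qpoch_inf q (q / b) * qpoch_inf q (b * q / (a * z))
            / (qpoch_inf q (q / a) * qpoch_inf q (b / (a * z)))
          * (\<Sum>n::nat. qpoch q (b / a) (int n) * qpoch q (b / (a * z)) (int n)
               / (qpoch q q (int n) * qpoch q (b * q / (a * z)) (int n)) * (q / b) ^ n)"
      \<comment> \<open>The prefactors (az)_\<infinity> and (bq/(az))_\<infinity> cancel the
        denominators in the values of the two right-hand series given by \<open>S1\<close> and
        \<open>S2\<close>.\<close>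
      unfolding infsumI[OF total] sums_unique[OF S1, symmetric] sums_unique[OF S2, symmetric] E1 E2
      using nz nz' by (simp add: mult_ac)
  qed (rule sums_summable[OF S1] sums_summable[OF S2])+
qed

end
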